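(* Let $0<s<1$, let $\Omega\subset\mathbb{R}^N$ be a bounded domain, and let $\Sigma_1,\Sigma_2$ be two open sets of positive measure with $\Sigma_1\cap\Sigma_2=\emptyset$ and $\overline{\Sigma_1}\cup\overline{\Sigma_2}=\mathbb{R}^N\setminus\Omega$. Let $\overline{\xi_0}$ be the solution of the mixed problem $$(-\Delta)^s\overline{\xi_0}=1\ \text{in }\Omega,\qquad \overline{\xi_0}=0\ \text{in }\Sigma_1,\qquad \mathcal{N}_s\overline{\xi_0}=0\ \text{in }\Sigma_2.$$ Then there exists a constant $c=c(N,s,\Omega,\Sigma_1,\Sigma_2)>0$ such that, for every $f\in\mathcal{C}_0^\infty(\Omega)$ with $f\geq 0$, the solution $u$ of $$(-\Delta)^s u=f\ \text{in }\Omega,\qquad u\geq 0\ \text{in }\mathbb{R}^N,\qquad u=0\ \text{in }\Sigma_1,\qquad \mathcal{N}_s u=0\ \text{in }\Sigma_2,$$ satisfies $$u(x)\geq c\left(\int_\Omega f(y)\,\overline{\xi_0}(y)\,dy\right)\overline{\xi_0}(x),\qquad x\in\Omega.$$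
   Context: The fractional Laplacian is $(-\Delta)^s u(x)=a_{N,s}\,\mathrm{P.V.}\int_{\mathbb{R}^N}\frac{u(x)-u(y)}{|x-y|^{N+2s}}\,dy$, with $a_{N,s}>0$ the usual normalization constant, and the nonlocal normal derivative is $\mathcal{N}_s u(x)=a_{N,s}\int_\Omega\frac{u(x)-u(y)}{|x-y|^{N+2s}}\,dy$ for $x\in\mathbb{R}^N\setminus\overline{\Omega}$. Let $Q:=\mathbb{R}^{2N}\setminus(\mathbb{R}^N\setminus\Omega)^2$ and let $E^s_{\Sigma_1}$ be the space of measurable $u:\mathbb{R}^N\to\mathbb{R}$ with $u=0$ in $\Sigma_1$ and $$\|u\|_{E^s_{\Sigma_1}}^2:=\int_\Omega u^2\,dx+\iint_Q\frac{|u(x)-u(y)|^2}{|x-y|^{N+2s}}\,dx\,dy<+\infty .$$ For a datum $h\in L^2(\Omega)$, the solution of $(-\Delta)^s w=h$ in $\Omega$, $w=0$ in $\Sigma_1$, $\mathcal{N}_s w=0$ in $\Sigma_2$ is understood in the weak sense: $w\in E^s_{\Sigma_1}$ and $$\frac{a_{N,s}}{2}\iint_Q\frac{(w(x)-w(y))(\varphi(x)-\varphi(y))}{|x-y|^{N+2s}}\,dx\,dy=\int_\Omega h\varphi\,dx\qquad\text{for every }\varphi\in E^s_{\Sigma_1}.$$ It exists and is unique. Functions are identified up to a.e. equality, and pointwise inequalities are understood accordingly. *)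

theory Defs
  imports "HOL-Analysis.Analysis"
begin

text \<open>
  The ambient space \<open>\<real>\<^sup>N\<close> is a type of class \<^class>\<open>euclidean_space\<close>, with \<open>N = DIM('a) \<ge> 1\<close>;
  \<open>\<real>\<^sup>2\<^sup>N\<close> is \<open>'a \<times> 'a\<close>, with its own Lebesgue measure.
\<close>

text \<open>
  The constant for which the fractional Laplacian has Fourier symbol \<open>\<bar>\<xi>\<bar> powr (2 * s)\<close>.
\<close>

definition frac_const :: "'a::euclidean_space itself \<Rightarrow> real \<Rightarrow> real" where
  "frac_const _ s =
     4 powr s * Gamma (real DIM('a) / 2 + s) / (pi powr (real DIM('a) / 2) * \<bar>Gamma (- s)\<bar>)"

text \<open>
  On the diagonal, a Lebesgue null set of \<open>'a \<times> 'a\<close>, the quotients below have the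
  conventional value \<open>0\<close>.
\<close>

definition frac_kernel :: "real \<Rightarrow> 'a::euclidean_space \<Rightarrow> 'a \<Rightarrow> real" where
  "frac_kernel s x y = 1 / norm (x - y) powr (real DIM('a) + 2 * s)"

definition Q_region :: "'a set \<Rightarrow> ('a \<times> 'a) set" where
  "Q_region \<Omega> = UNIV - (UNIV - \<Omega>) \<times> (UNIV - \<Omega>)"

definition energy_norm_sq ::
    "real \<Rightarrow> 'a::euclidean_space set \<Rightarrow> ('a \<Rightarrow> real) \<Rightarrow> ennreal" where
  "energy_norm_sq s \<Omega> u =
     (\<integral>\<^sup>+ x\<in>\<Omega>. ennreal ((u x)\<^sup>2) \<partial>lebesgue) +
     (\<integral>\<^sup>+ p\<in>Q_region \<Omega>. ennreal (\<bar>u (fst p) - u (snd p)\<bar>\<^sup>2 * frac_kernel s (fst p) (snd p))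
        \<partial>(lebesgue :: ('a \<times> 'a) measure))"

definition energy_space ::
    "real \<Rightarrow> 'a::euclidean_space set \<Rightarrow> 'a set \<Rightarrow> ('a \<Rightarrow> real) set" where
  "energy_space s \<Omega> \<Sigma>\<^sub>1 =
     {u. u \<in> borel_measurable lebesgue \<and>
         (AE x in lebesgue. x \<in> \<Sigma>\<^sub>1 \<longrightarrow> u x = 0) \<and>
         energy_norm_sq s \<Omega> u < \<infinity>}"

text \<open>
  For \<open>w\<close> and \<open>\<phi>\<close> in the energy space the integrand is integrable on \<open>Q_region \<Omega>\<close>
  by the Cauchy-Schwarz inequality, so this integral is a genuine one there.
\<close>

definition energy_form ::
    "real \<Rightarrow> 'a::euclidean_space set \<Rightarrow> ('a \<Rightarrow> real) \<Rightarrow> ('a \<Rightarrow> real) \<Rightarrow> real" where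
  "energy_form s \<Omega> w \<phi> =
     frac_const TYPE('a) s / 2 *
     set_lebesgue_integral (lebesgue :: ('a \<times> 'a) measure) (Q_region \<Omega>)
       (\<lambda>p. (w (fst p) - w (snd p)) * (\<phi> (fst p) - \<phi> (snd p)) * frac_kernel s (fst p) (snd p))"

text \<open>
  Weak solutions of \<open>(-\<Delta>)\<^sup>s w = h\<close> in \<open>\<Omega>\<close>, \<open>w = 0\<close> in \<open>\<Sigma>\<^sub>1\<close>, with vanishing nonlocal normal
  derivative in \<open>\<Sigma>\<^sub>2\<close>, for a datum \<open>h\<close> that is square integrable on \<open>\<Omega>\<close>. The Neumann condition is the
  natural condition of the weak formulation: test functions are unrestricted on \<open>\<Sigma>\<^sub>2\<close>, which
  therefore does not occur as a parameter.
\<close>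

definition mixed_weak_solution ::
    "real \<Rightarrow> 'a::euclidean_space set \<Rightarrow> 'a set \<Rightarrow> ('a \<Rightarrow> real) \<Rightarrow> ('a \<Rightarrow> real) \<Rightarrow> bool" where
  "mixed_weak_solution s \<Omega> \<Sigma>\<^sub>1 h w \<longleftrightarrow>
     w \<in> energy_space s \<Omega> \<Sigma>\<^sub>1 \<and>
     (\<forall>\<phi>\<in>energy_space s \<Omega> \<Sigma>\<^sub>1.
        energy_form s \<Omega> w \<phi> = set_lebesgue_integral lebesgue \<Omega> (\<lambda>x. h x * \<phi> x))"

primrec C_k :: "nat \<Rightarrow> ('a::euclidean_space \<Rightarrow> real) \<Rightarrow> bool" where
  "C_k 0 f \<longleftrightarrow> continuous_on UNIV f"
| "C_k (Suc k) f \<longleftrightarrow>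
     (\<forall>x. f differentiable (at x)) \<and>
     (\<forall>b\<in>Basis. C_k k (\<lambda>x. frechet_derivative f (at x) b))"

text \<open>
  Elements of \<open>C\<^sub>0\<^sup>\<infinity>(\<Omega>)\<close> are represented by their extensions by zero to the whole space.
\<close>

definition test_functions :: "'a::euclidean_space set \<Rightarrow> ('a \<Rightarrow> real) set" where
  "test_functions \<Omega> =
     {f. (\<forall>k. C_k k f) \<and> compact (closure {x. f x \<noteq> 0}) \<and> closure {x. f x \<noteq> 0} \<subseteq> \<Omega>}"

end

theory Submission
  imports Defs
begin

text \<open>
  The estimate rests on the fact that the kernel is bounded below on a bounded set. Write \<open>a\<close> for
  the normalization constant and fix \<open>\<kappa> > 0\<close> with
  \<open>\<kappa> \<le> \<bar>x - y\<bar> powr (- N - 2 * s)\<close> on \<open>\<Omega> \<times> \<Omega>\<close>. Subtracting \<open>\<kappa>\<close> from the kernel there leaves a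
  nonnegative kernel, whose form is denoted by \<open>B'\<close>. The part taken away can be computed, and
  for a solution \<open>u\<close> with datum \<open>f\<close> the weak equation becomes
  \<open>B'(u, \<phi>) + a \<kappa> \<bar>\<Omega>\<bar> \<integral>\<^bsub>\<Omega>\<^esub> u \<phi> = \<integral>\<^bsub>\<Omega>\<^esub> f \<phi> + a \<kappa> (\<integral>\<^bsub>\<Omega>\<^esub> u) (\<integral>\<^bsub>\<Omega>\<^esub> \<phi>)\<close>.
  Thus \<open>u\<close> solves a problem with a zero-order term and the datum \<open>f + a \<kappa> \<integral>\<^bsub>\<Omega>\<^esub> u\<close>, which is at least
  the constant \<open>a \<kappa> \<integral>\<^bsub>\<Omega>\<^esub> u\<close>, whereas \<open>\<xi>\<close>, the solution with datum \<open>1\<close>, solves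
  the same problem with the constant datum \<open>1 + a \<kappa> m\<close>, where \<open>m = \<integral>\<^bsub>\<Omega>\<^esub> \<xi>\<close>. The weak maximum
  principle gives \<open>u \<ge> t \<xi>\<close> in \<open>\<Omega>\<close> for \<open>t = a \<kappa> (\<integral>\<^bsub>\<Omega>\<^esub> u) / (1 + a \<kappa> m)\<close>.

  Finally \<open>\<integral>\<^bsub>\<Omega>\<^esub> u = \<integral>\<^bsub>\<Omega>\<^esub> f \<xi>\<close>, because the form is symmetric and each of \<open>u\<close> and \<open>\<xi>\<close> is an
  admissible test function in the equation of the other (\<open>mixed_weak_solution_swap\<close>). For two
  solutions with datum \<open>1\<close> the same identity shows that \<open>m\<close> does not depend on \<open>\<xi>\<close>, so
  \<open>c = a \<kappa> / (1 + a \<kappa> m)\<close> is a constant of the required kind. The inequality that carries the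
  maximum principle is \<open>energy_form_pos_part_ge\<close>: testing with the positive part \<open>\<phi>\<close> of
  \<open>v = t \<xi> - u\<close> makes \<open>B'(v, \<phi>)\<close> nonnegative, so it can be discarded, and what remains forces
  \<open>a \<kappa> \<bar>\<Omega>\<bar> \<integral>\<^bsub>\<Omega>\<^esub> \<phi>\<^sup>2 \<le> 0\<close>.
\<close>

section \<open>Tensor products under Lebesgue measure\<close>

text \<open>
  Lebesgue measure on a product space is the completion of the product measure rather than the
  product of the completions. Lebesgue measurable functions of one variable therefore pull
  back to measurable functions of two only because the cylinder over a null set is null.
\<close>

lemma null_sets_vimage_fst:
  assumes "N \<in> null_sets (lborel :: 'a::euclidean_space measure)"
  shows "fst -` N \<in> null_sets (lborel :: ('a \<times> 'b::euclidean_space) measure)"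
proof -
  have "N \<times> (UNIV :: 'b set) \<in> null_sets (lborel \<Otimes>\<^sub>M lborel)"
    using assms by (auto simp: null_sets_def lborel.emeasure_pair_measure_Times)
  moreover have "fst -` N = N \<times> (UNIV :: 'b set)" by auto
  ultimately show ?thesis by (simp add: lborel_prod)
qed

lemma null_sets_vimage_snd:
  assumes "N \<in> null_sets (lborel :: 'b::euclidean_space measure)"
  shows "snd -` N \<in> null_sets (lborel :: ('a::euclidean_space \<times> 'b) measure)"
proof -
  have "(UNIV :: 'a set) \<times> N \<in> null_sets (lborel \<Otimes>\<^sub>M lborel)"
    using assms by (auto simp: null_sets_def lborel.emeasure_pair_measure_Times)
  moreover have "snd -` N = (UNIV :: 'a set) \<times> N" by auto
  ultimately show ?thesis by (simp add: lborel_prod)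
qed

lemma measurable_fst_lebesgue [measurable]:
  "fst \<in> (lebesgue :: ('a::euclidean_space \<times> 'b::euclidean_space) measure) \<rightarrow>\<^sub>M lebesgue"
proof (rule completion.measurable_completion2)
  show fst: "fst \<in> (lebesgue :: ('a \<times> 'b) measure) \<rightarrow>\<^sub>M lborel"
    by (intro measurable_completion) (simp add: borel_measurable_continuous_onI continuous_on_fst)
  show "null_sets lborel \<subseteq> null_sets (distr (lebesgue :: ('a \<times> 'b) measure) lborel fst)"
    using null_sets_vimage_fst[where 'a='a and 'b='b] null_setsD2[of _ lborel]
    by (auto simp: null_sets_distr_iff[OF fst] simp del: sets_lborel intro!: null_sets_completionI)
qed

lemma measurable_snd_lebesgue [measurable]:
  "snd \<in> (lebesgue :: ('a::euclidean_space \<times> 'b::euclidean_space) measure) \<rightarrow>\<^sub>M lebesgue"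
proof (rule completion.measurable_completion2)
  show snd: "snd \<in> (lebesgue :: ('a \<times> 'b) measure) \<rightarrow>\<^sub>M lborel"
    by (intro measurable_completion) (simp add: borel_measurable_continuous_onI continuous_on_snd)
  show "null_sets lborel \<subseteq> null_sets (distr (lebesgue :: ('a \<times> 'b) measure) lborel snd)"
    using null_sets_vimage_snd[where 'a='a and 'b='b] null_setsD2[of _ lborel]
    by (auto simp: null_sets_distr_iff[OF snd] simp del: sets_lborel intro!: null_sets_completionI)
qed

lemma has_bochner_integral_tensor_lborel:
  fixes G :: "'a::euclidean_space \<Rightarrow> real" and H :: "'b::euclidean_space \<Rightarrow> real"
  assumes G: "integrable lborel G" and H: "integrable lborel H"
  shows "has_bochner_integral lborel (\<lambda>p. G (fst p) * H (snd p)) (integral\<^sup>L lborel G * integral\<^sup>L lborel H)"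
proof -
  note [measurable] = borel_measurable_integrable[OF G] borel_measurable_integrable[OF H]
  have int: "integrable (lborel \<Otimes>\<^sub>M lborel) (\<lambda>p. G (fst p) * H (snd p))"
    by (rule lborel_pair.Fubini_integrable) (auto simp: abs_mult G H)
  have "integral\<^sup>L (lborel \<Otimes>\<^sub>M lborel) (\<lambda>p. G (fst p) * H (snd p)) = integral\<^sup>L lborel G * integral\<^sup>L lborel H"
    using lborel_pair.integral_fst'[OF int] by simp
  with int show ?thesis by (simp add: has_bochner_integral_iff lborel_prod)
qed

lemma AE_lebesgue_fst:
  assumes "AE x in (lborel :: 'a::euclidean_space measure). P x"
  shows "AE p in (lebesgue :: ('a \<times> 'b::euclidean_space) measure). P (fst p)"
proof -
  obtain N where N: "N \<in> null_sets lborel" "{x. \<not> P x} \<subseteq> N"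
    using assms by (auto elim!: AE_E simp: null_sets_def)
  show ?thesis
    by (rule AE_completion, rule AE_I'[OF null_sets_vimage_fst[OF N(1)]]) (use N(2) in auto)
qed

lemma AE_lebesgue_snd:
  assumes "AE x in (lborel :: 'b::euclidean_space measure). P x"
  shows "AE p in (lebesgue :: ('a::euclidean_space \<times> 'b) measure). P (snd p)"
proof -
  obtain N where N: "N \<in> null_sets lborel" "{x. \<not> P x} \<subseteq> N"
    using assms by (auto elim!: AE_E simp: null_sets_def)
  show ?thesis
    by (rule AE_completion, rule AE_I'[OF null_sets_vimage_snd[OF N(1)]]) (use N(2) in auto)
qed

lemma integrable_lebesgue_borel_version:
  fixes G :: "'a::euclidean_space \<Rightarrow> real"
  assumes G: "integrable lebesgue G"
  obtains G' where "integrable lborel G'" "integral\<^sup>L lborel G' = integral\<^sup>L lebesgue G"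
    "AE x in lborel. G x = G' x"
proof -
  obtain G' where G' [measurable]: "G' \<in> borel_measurable lborel" and eq: "AE x in lborel. G x = G' x"
    using completion_ex_borel_measurable_real[OF borel_measurable_integrable[OF G]] by auto
  have m: "G' \<in> borel_measurable lebesgue" by (auto intro: measurable_completion)
  have "integrable lebesgue G'" "integral\<^sup>L lebesgue G' = integral\<^sup>L lebesgue G"
    using G m AE_completion[OF eq] integrable_cong_AE[of G lebesgue G'] integral_cong_AE[of G lebesgue G']
    by auto
  with that[of G'] eq show thesis
    by (simp add: integrable_completion integral_completion)
qed

text \<open>
  Fubini's theorem for product functions holds for the uncompleted measures and is carried
  over to the completions by passing to Borel representatives.
\<close>

lemma has_bochner_integral_tensor_lebesgue:
  fixes G :: "'a::euclidean_space \<Rightarrow> real" and H :: "'b::euclidean_space \<Rightarrow> real"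
  assumes G: "integrable lebesgue G" and H: "integrable lebesgue H"
  shows "has_bochner_integral lebesgue (\<lambda>p. G (fst p) * H (snd p)) (integral\<^sup>L lebesgue G * integral\<^sup>L lebesgue H)"
proof -
  note [measurable] = borel_measurable_integrable[OF G] borel_measurable_integrable[OF H]
  obtain G' where G': "integrable lborel G'" "integral\<^sup>L lborel G' = integral\<^sup>L lebesgue G"
    "AE x in lborel. G x = G' x"
    using integrable_lebesgue_borel_version[OF G] .
  obtain H' where H': "integrable lborel H'" "integral\<^sup>L lborel H' = integral\<^sup>L lebesgue H"
    "AE x in lborel. H x = H' x"
    using integrable_lebesgue_borel_version[OF H] .
  let ?f = "\<lambda>p. G (fst p) * H (snd p)" and ?f' = "\<lambda>p. G' (fst p) * H' (snd p)"
  have lborel: "has_bochner_integral lborel ?f' (integral\<^sup>L lebesgue G * integral\<^sup>L lebesgue H)"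
    using has_bochner_integral_tensor_lborel[OF G'(1) H'(1)] G'(2) H'(2) by simp
  then have m: "?f' \<in> borel_measurable lborel"
    by (auto simp: has_bochner_integral_iff)
  then have *: "has_bochner_integral lebesgue ?f' (integral\<^sup>L lebesgue G * integral\<^sup>L lebesgue H)"
    using lborel integrable_completion[OF m] integral_completion[OF m]
    by (simp add: has_bochner_integral_iff)
  have "AE p in lebesgue. ?f p = ?f' p"
    using AE_lebesgue_fst[OF G'(3)] AE_lebesgue_snd[OF H'(3)] by eventually_elim simp
  moreover have "?f \<in> borel_measurable lebesgue" by measurable
  moreover have "?f' \<in> borel_measurable lebesgue" using m by (rule measurable_completion)
  ultimately show ?thesis
    using * has_bochner_integral_cong_AE[of ?f lebesgue ?f'] by blast
qed

section \<open>The kernel and its constant\<close>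

text \<open>
  As \<open>- s\<close> lies strictly between the two poles \<open>- 1\<close> and \<open>0\<close> of the Gamma function, \<open>Gamma (- s)\<close> is a
  genuine nonzero value; at a pole the conventional value \<open>0\<close> would make the constant vanish.
\<close>

lemma frac_const_pos:
  assumes "0 < s" "s < 1"
  shows "frac_const TYPE('a::euclidean_space) s > 0"
proof -
  have "- s \<notin> \<int>"
  proof
    assume "- s \<in> \<int>"
    then obtain k :: int where "- s = of_int k" by (rule Ints_cases)
    with assms have "k < 0" "k > -1" by linarith+
    then show False by linarith
  qed
  then have "Gamma (- s) \<noteq> 0"
    by (auto simp: Gamma_eq_zero_iff dest: nonpos_Ints_Int)
  moreover have "Gamma (real DIM('a) / 2 + s) > 0"
    using assms by (intro Gamma_real_pos) (simp add: add_nonneg_pos)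
  ultimately show ?thesis
    by (simp add: frac_const_def)
qed

lemma frac_kernel_nonneg: "frac_kernel s x y \<ge> 0"
  by (simp add: frac_kernel_def)

text \<open>
  The kernel decreases with the distance, and distances in \<open>\<Omega>\<close> are bounded. On the diagonal the
  conventional value \<open>0\<close> breaks the bound, hence \<open>x \<noteq> y\<close>.
\<close>

lemma frac_kernel_lower_bound:
  fixes \<Omega> :: "'a::euclidean_space set"
  assumes "s > 0" "bounded \<Omega>"
  obtains \<kappa> where "\<kappa> > 0" "\<And>x y. x \<in> \<Omega> \<Longrightarrow> y \<in> \<Omega> \<Longrightarrow> x \<noteq> y \<Longrightarrow> \<kappa> \<le> frac_kernel s x y"
proof -
  obtain R where R: "R > 0" "\<And>x. x \<in> \<Omega> \<Longrightarrow> norm x \<le> R"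
    using assms(2) bounded_pos by blast
  have "1 / (2 * R) powr (real DIM('a) + 2 * s) \<le> frac_kernel s x y"
    if "x \<in> \<Omega>" "y \<in> \<Omega>" "x \<noteq> y" for x y
  proof -
    have "norm (x - y) \<le> 2 * R"
      using norm_triangle_ineq4[of x y] R(2)[OF that(1)] R(2)[OF that(2)] by simp
    then show ?thesis
      unfolding frac_kernel_def using that(3) assms(1) R(1)
      by (intro divide_left_mono powr_mono2 mult_pos_pos) auto
  qed
  with R(1) show thesis
    by (intro that[of "1 / (2 * R) powr (real DIM('a) + 2 * s)"]) auto
qed

lemma frac_kernel_measurable [measurable]:
  "(\<lambda>p. frac_kernel s (fst p) (snd p)) \<in> borel_measurable (lebesgue :: ('a::euclidean_space \<times> 'a) measure)"
  unfolding frac_kernel_def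
  by (intro measurable_completion) (simp add: borel_prod[symmetric])

section \<open>The energy space and its form\<close>

lemma Q_region_measurable:
  assumes "open \<Omega>"
  shows "Q_region \<Omega> \<in> sets (lebesgue :: ('a::euclidean_space \<times> 'a) measure)"
proof -
  have "Q_region \<Omega> = \<Omega> \<times> UNIV \<union> UNIV \<times> \<Omega>" by (auto simp: Q_region_def)
  then have "open (Q_region \<Omega>)" using assms by (auto intro: open_Times)
  then show ?thesis by simp
qed

definition energy_density :: "real \<Rightarrow> ('a::euclidean_space \<Rightarrow> real) \<Rightarrow> ('a \<Rightarrow> real) \<Rightarrow> 'a \<times> 'a \<Rightarrow> real" where
  "energy_density s u v p =
     (u (fst p) - u (snd p)) * (v (fst p) - v (snd p)) * frac_kernel s (fst p) (snd p)"

lemma energy_density_measurable [measurable]: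
  assumes [measurable]: "u \<in> borel_measurable lebesgue" "v \<in> borel_measurable lebesgue"
  shows "energy_density s u v \<in> borel_measurable lebesgue"
  unfolding energy_density_def by measurable

lemma set_integrable_nonneg_iff:
  fixes f :: "'a \<Rightarrow> real"
  assumes [measurable]: "f \<in> borel_measurable M" "A \<in> sets M" and "\<And>x. f x \<ge> 0"
  shows "set_integrable M A f \<longleftrightarrow> (\<integral>\<^sup>+ x\<in>A. ennreal (f x) \<partial>M) < \<infinity>"
proof -
  have "(\<integral>\<^sup>+ x. ennreal (norm (indicator A x *\<^sub>R f x)) \<partial>M) = (\<integral>\<^sup>+ x\<in>A. ennreal (f x) \<partial>M)"
    using assms(3) by (intro nn_integral_cong) (auto simp: indicator_def)
  then show ?thesis
    by (simp add: set_integrable_def integrable_iff_bounded)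
qed

text \<open>
  Finiteness of the extended norm is traded for Bochner integrability, which makes closure of the
  energy space under algebraic operations a matter of adding and dominating integrable functions.
\<close>

lemma energy_space_iff:
  assumes "open \<Omega>"
  shows "u \<in> energy_space s \<Omega> \<Sigma> \<longleftrightarrow>
    u \<in> borel_measurable lebesgue \<and> (AE x in lebesgue. x \<in> \<Sigma> \<longrightarrow> u x = 0) \<and>
    set_integrable lebesgue \<Omega> (\<lambda>x. (u x)\<^sup>2) \<and> set_integrable lebesgue (Q_region \<Omega>) (energy_density s u u)"
proof (cases "u \<in> borel_measurable lebesgue")
  case True
  note [measurable] = True
  have "set_integrable lebesgue \<Omega> (\<lambda>x. (u x)\<^sup>2) \<longleftrightarrow> (\<integral>\<^sup>+ x\<in>\<Omega>. ennreal ((u x)\<^sup>2) \<partial>lebesgue) < \<infinity>"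
    using assms by (intro set_integrable_nonneg_iff) auto
  moreover have "set_integrable lebesgue (Q_region \<Omega>) (energy_density s u u) \<longleftrightarrow>
    (\<integral>\<^sup>+ p\<in>Q_region \<Omega>. ennreal (energy_density s u u p) \<partial>lebesgue) < \<infinity>"
    by (intro set_integrable_nonneg_iff Q_region_measurable assms)
      (auto simp: energy_density_def frac_kernel_nonneg)
  moreover have "\<bar>u (fst p) - u (snd p)\<bar>\<^sup>2 * frac_kernel s (fst p) (snd p) = energy_density s u u p" for p
    by (simp add: energy_density_def power2_eq_square)
  ultimately show ?thesis
    using True by (simp add: energy_space_def energy_norm_sq_def)
qed (simp add: energy_space_def)

lemma set_integrable_mult_of_squares:
  fixes f g :: "'a \<Rightarrow> real"
  assumes [measurable]: "f \<in> borel_measurable M" "g \<in> borel_measurable M" "A \<in> sets M"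
    and f: "set_integrable M A (\<lambda>x. (f x)\<^sup>2)" and g: "set_integrable M A (\<lambda>x. (g x)\<^sup>2)"
  shows "set_integrable M A (\<lambda>x. f x * g x)"
proof (rule set_integrable_bound)
  show "set_integrable M A (\<lambda>x. (f x)\<^sup>2 + (g x)\<^sup>2)"
    using f g by (rule set_integral_add)
  have "\<bar>a * b\<bar> \<le> a\<^sup>2 + b\<^sup>2" for a b :: real
    using sum_squares_bound[of "\<bar>a\<bar>" "\<bar>b\<bar>"] mult_nonneg_nonneg[of "\<bar>a\<bar>" "\<bar>b\<bar>"]
    unfolding abs_mult power2_abs by linarith
  then show "AE x in M. x \<in> A \<longrightarrow> norm (f x * g x) \<le> norm ((f x)\<^sup>2 + (g x)\<^sup>2)"
    by simp
qed (simp add: set_borel_measurable_def)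

text \<open>
  The square root of the kernel is shared between the two difference quotients, so that the density
  becomes a product of two square integrable functions.
\<close>

lemma energy_density_integrable:
  assumes \<Omega>: "open \<Omega>" and u: "u \<in> energy_space s \<Omega> \<Sigma>" and v: "v \<in> energy_space s \<Omega> \<Sigma>"
  shows "set_integrable lebesgue (Q_region \<Omega>) (energy_density s u v)"
proof -
  note * = u[unfolded energy_space_iff[OF \<Omega>]] v[unfolded energy_space_iff[OF \<Omega>]]
  then have [measurable]: "u \<in> borel_measurable lebesgue" "v \<in> borel_measurable lebesgue" by auto
  let ?D = "\<lambda>u p. (u (fst p) - u (snd p)) * sqrt (frac_kernel s (fst p) (snd p))"
  have mult: "?D u p * ?D v p = energy_density s u v p" for u v :: "'a \<Rightarrow> real" and p
    by (simp add: energy_density_def frac_kernel_nonneg)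
  have "set_integrable lebesgue (Q_region \<Omega>) (\<lambda>p. ?D u p * ?D v p)"
    using * by (intro set_integrable_mult_of_squares Q_region_measurable \<Omega>)
      (auto simp only: power2_eq_square mult, measurable)
  then show ?thesis by (simp only: mult)
qed

lemma energy_form_eq:
  "energy_form s \<Omega> (u :: 'a::euclidean_space \<Rightarrow> real) v =
     frac_const TYPE('a) s / 2 * (LINT p:Q_region \<Omega>|lebesgue. energy_density s u v p)"
  by (simp add: energy_form_def energy_density_def)

lemma energy_form_commute: "energy_form s \<Omega> u v = energy_form s \<Omega> v u"
  by (simp add: energy_form_def mult.commute mult.left_commute)

lemma energy_form_nonneg:
  fixes u :: "'a::euclidean_space \<Rightarrow> real"
  assumes "0 < s" "s < 1"
  shows "energy_form s \<Omega> u u \<ge> 0"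
  using frac_const_pos[OF assms, where 'a='a]
  by (auto simp: energy_form_eq energy_density_def frac_kernel_nonneg set_lebesgue_integral_def
      intro!: mult_nonneg_nonneg Bochner_Integration.integral_nonneg)

lemma energy_form_scale_diff:
  assumes "open \<Omega>" "u \<in> energy_space s \<Omega> \<Sigma>" "v \<in> energy_space s \<Omega> \<Sigma>" "\<phi> \<in> energy_space s \<Omega> \<Sigma>"
  shows "energy_form s \<Omega> (\<lambda>x. t * u x - v x) \<phi> = t * energy_form s \<Omega> u \<phi> - energy_form s \<Omega> v \<phi>"
proof -
  have "energy_density s (\<lambda>x. t * u x - v x) \<phi> = (\<lambda>p. t * energy_density s u \<phi> p - energy_density s v \<phi> p)"
    by (auto simp: energy_density_def algebra_simps)
  moreover have "(LINT p:Q_region \<Omega>|lebesgue. t * energy_density s u \<phi> p - energy_density s v \<phi> p) =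
    t * (LINT p:Q_region \<Omega>|lebesgue. energy_density s u \<phi> p) - (LINT p:Q_region \<Omega>|lebesgue. energy_density s v \<phi> p)"
    using assms by (subst set_integral_diff(2)) (auto intro!: energy_density_integrable)
  ultimately show ?thesis
    by (simp only: energy_form_eq) (simp add: right_diff_distrib)
qed

lemma energy_space_scale_diff:
  assumes \<Omega>: "open \<Omega>" and u: "u \<in> energy_space s \<Omega> \<Sigma>" and v: "v \<in> energy_space s \<Omega> \<Sigma>"
  shows "(\<lambda>x. t * u x - v x) \<in> energy_space s \<Omega> \<Sigma>"
proof -
  note * = u[unfolded energy_space_iff[OF \<Omega>]] v[unfolded energy_space_iff[OF \<Omega>]]
  then have [measurable]: "u \<in> borel_measurable lebesgue" "v \<in> borel_measurable lebesgue" by auto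
  have "set_integrable lebesgue \<Omega> (\<lambda>x. u x * v x)"
    using * \<Omega> by (intro set_integrable_mult_of_squares) auto
  then have "set_integrable lebesgue \<Omega> (\<lambda>x. (t\<^sup>2 * (u x)\<^sup>2 - 2 * t * (u x * v x)) + (v x)\<^sup>2)"
    using * by (intro set_integral_add(1) set_integral_diff(1) set_integrable_mult_right) auto
  moreover have "(\<lambda>x. (t\<^sup>2 * (u x)\<^sup>2 - 2 * t * (u x * v x)) + (v x)\<^sup>2) = (\<lambda>x. (t * u x - v x)\<^sup>2)"
    by (auto simp: power2_eq_square algebra_simps)
  moreover have "set_integrable lebesgue (Q_region \<Omega>)
    (\<lambda>p. (t\<^sup>2 * energy_density s u u p - 2 * t * energy_density s u v p) + energy_density s v v p)"
    using \<Omega> u v by (intro set_integral_add(1) set_integral_diff(1) set_integrable_mult_right)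
      (auto intro: energy_density_integrable)
  moreover have "(\<lambda>p. (t\<^sup>2 * energy_density s u u p - 2 * t * energy_density s u v p) + energy_density s v v p) =
    energy_density s (\<lambda>x. t * u x - v x) (\<lambda>x. t * u x - v x)"
    by (auto simp: energy_density_def power2_eq_square algebra_simps)
  moreover have "AE x in lebesgue. x \<in> \<Sigma> \<longrightarrow> t * u x - v x = 0"
    using conjunct1[OF conjunct2[OF *(1)]] conjunct1[OF conjunct2[OF *(2)]] by eventually_elim auto
  ultimately show ?thesis
    by (simp add: energy_space_iff[OF \<Omega>])
qed

text \<open>
  The positive part is a contraction of the real line, so it decreases both parts of the norm.
\<close>

lemma energy_space_pos_part:
  assumes \<Omega>: "open \<Omega>" and v: "v \<in> energy_space s \<Omega> \<Sigma>"
  shows "(\<lambda>x. max (v x) 0) \<in> energy_space s \<Omega> \<Sigma>"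
proof -
  note * = v[unfolded energy_space_iff[OF \<Omega>]]
  then have m: "(\<lambda>x. max (v x) 0) \<in> borel_measurable lebesgue"
    by (intro borel_measurable_max) auto
  have sq: "(max a 0)\<^sup>2 \<le> a\<^sup>2" "(max a 0 - max b 0) * (max a 0 - max b 0) \<le> (a - b) * (a - b)" for a b :: real
    using abs_le_square_iff[of "max a 0" a] abs_le_square_iff[of "max a 0 - max b 0" "a - b"]
    by (auto simp: power2_eq_square)
  have "set_integrable lebesgue \<Omega> (\<lambda>x. (max (v x) 0)\<^sup>2)"
  proof (rule set_integrable_bound)
    show "set_integrable lebesgue \<Omega> (\<lambda>x. (v x)\<^sup>2)" using * by blast
    show "set_borel_measurable lebesgue \<Omega> (\<lambda>x. (max (v x) 0)\<^sup>2)"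
      unfolding set_borel_measurable_def
      using \<Omega> by (intro borel_measurable_scaleR borel_measurable_indicator borel_measurable_power m) auto
    show "AE x in lebesgue. x \<in> \<Omega> \<longrightarrow> norm ((max (v x) 0)\<^sup>2) \<le> norm ((v x)\<^sup>2)"
      by (simp add: sq(1))
  qed
  moreover have "set_integrable lebesgue (Q_region \<Omega>) (energy_density s (\<lambda>x. max (v x) 0) (\<lambda>x. max (v x) 0))"
  proof (rule set_integrable_bound)
    show "set_integrable lebesgue (Q_region \<Omega>) (energy_density s v v)" using * by blast
    show "set_borel_measurable lebesgue (Q_region \<Omega>) (energy_density s (\<lambda>x. max (v x) 0) (\<lambda>x. max (v x) 0))"
      unfolding set_borel_measurable_def
      by (intro borel_measurable_scaleR borel_measurable_indicator Q_region_measurable \<Omega>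
          energy_density_measurable m)
    have "norm (energy_density s (\<lambda>x. max (v x) 0) (\<lambda>x. max (v x) 0) p) \<le> norm (energy_density s v v p)" for p
      using mult_right_mono[OF sq(2)[of "v (fst p)" "v (snd p)"] frac_kernel_nonneg]
      by (simp add: energy_density_def frac_kernel_nonneg abs_mult)
    then show "AE p in lebesgue. p \<in> Q_region \<Omega> \<longrightarrow>
      norm (energy_density s (\<lambda>x. max (v x) 0) (\<lambda>x. max (v x) 0) p) \<le> norm (energy_density s v v p)" by simp
  qed
  moreover have "AE x in lebesgue. x \<in> \<Sigma> \<longrightarrow> max (v x) 0 = 0"
    using conjunct1[OF conjunct2[OF *]] by eventually_elim simp
  ultimately show ?thesis
    unfolding energy_space_iff[OF \<Omega>] using m by (intro conjI)
qed

lemma energy_space_integrable: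
  assumes \<Omega>: "open \<Omega>" "bounded \<Omega>" and u: "u \<in> energy_space s \<Omega> \<Sigma>"
  shows "set_integrable lebesgue \<Omega> u"
proof -
  note * = u[unfolded energy_space_iff[OF \<Omega>(1)]]
  have "integrable lebesgue (indicator \<Omega> :: 'a \<Rightarrow> real)"
    using \<Omega> lmeasurable_open[of \<Omega>] by (simp add: fmeasurable_def)
  then have "set_integrable lebesgue \<Omega> (\<lambda>x. u x * 1)"
    using * \<Omega>(1) by (intro set_integrable_mult_of_squares) (auto simp: set_integrable_def)
  then show ?thesis by simp
qed

section \<open>Comparison of solutions\<close>

text \<open>
  The integrand of the form is nonnegative because \<open>r \<mapsto> max r 0\<close> is increasing, so its integral only
  decreases when the region is cut down to \<open>\<Omega> \<times> \<Omega>\<close> and the kernel is replaced by its lower bound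
  \<open>\<kappa>\<close> there. For a constant kernel the double integral of \<open>(v x - v y) * (\<phi> x - \<phi> y)\<close> multiplies out into
  four tensor products, and \<open>v * \<phi> = \<phi>\<^sup>2\<close>. The term with \<open>\<phi>\<^sup>2\<close> is the coercive zero-order term of
  the maximum principle.
\<close>

lemma energy_form_pos_part_ge:
  fixes \<Omega> :: "'a::euclidean_space set"
  assumes s: "0 < s" "s < 1" and \<Omega>: "open \<Omega>" "bounded \<Omega>"
    and \<kappa>: "\<kappa> > 0" "\<And>x y. x \<in> \<Omega> \<Longrightarrow> y \<in> \<Omega> \<Longrightarrow> x \<noteq> y \<Longrightarrow> \<kappa> \<le> frac_kernel s x y"
    and v: "v \<in> energy_space s \<Omega> \<Sigma>"
  defines "\<phi> \<equiv> \<lambda>x. max (v x) 0"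
  shows "frac_const TYPE('a) s * \<kappa> *
      (measure lebesgue \<Omega> * (LINT x:\<Omega>|lebesgue. (\<phi> x)\<^sup>2) - (LINT x:\<Omega>|lebesgue. v x) * (LINT x:\<Omega>|lebesgue. \<phi> x))
    \<le> energy_form s \<Omega> v \<phi>"
proof -
  have \<phi>: "\<phi> \<in> energy_space s \<Omega> \<Sigma>"
    unfolding \<phi>_def using \<Omega>(1) v by (rule energy_space_pos_part)
  \<comment> \<open>The factors of the four tensor products, extended by zero outside \<open>\<Omega>\<close>; \<open>P\<close> stands for \<open>v * \<phi>\<close>.\<close>
  define I V F P where "I = (indicator \<Omega> :: 'a \<Rightarrow> real)" and "V x = indicator \<Omega> x * v x"
    and "F x = indicator \<Omega> x * \<phi> x" and "P x = indicator \<Omega> x * (\<phi> x)\<^sup>2" for x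
  have int: "integrable lebesgue I" "integrable lebesgue V" "integrable lebesgue F" "integrable lebesgue P"
    using \<Omega> lmeasurable_open[of \<Omega>] energy_space_integrable[OF \<Omega> v] energy_space_integrable[OF \<Omega> \<phi>]
      \<phi>[unfolded energy_space_iff[OF \<Omega>(1)]]
    by (auto simp: I_def V_def[abs_def] F_def[abs_def] P_def[abs_def] set_integrable_def fmeasurable_def)
  let ?X = "\<lambda>p. \<kappa> * (P (fst p) * I (snd p) - V (fst p) * F (snd p) - F (fst p) * V (snd p) + I (fst p) * P (snd p))"
  note tensor = has_bochner_integral_tensor_lebesgue
  have X: "has_bochner_integral lebesgue ?X
    (\<kappa> * (integral\<^sup>L lebesgue P * integral\<^sup>L lebesgue I - integral\<^sup>L lebesgue V * integral\<^sup>L lebesgue F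
      - integral\<^sup>L lebesgue F * integral\<^sup>L lebesgue V + integral\<^sup>L lebesgue I * integral\<^sup>L lebesgue P))"
    by (intro has_bochner_integral_mult_right has_bochner_integral_add has_bochner_integral_diff tensor int)
  have density: "integrable lebesgue (\<lambda>p. indicator (Q_region \<Omega>) p *\<^sub>R energy_density s v \<phi> p)"
    using energy_density_integrable[OF \<Omega>(1) v \<phi>] by (simp add: set_integrable_def)
  have mono: "(a - b) * (max a 0 - max b 0) \<ge> 0" for a b :: real
    by (auto simp: max_def mult_nonneg_nonneg mult_nonpos_nonneg mult_nonpos_nonpos mult_le_0_iff)
  have le: "?X p \<le> indicator (Q_region \<Omega>) p *\<^sub>R energy_density s v \<phi> p" for p
  proof (cases "p \<in> \<Omega> \<times> \<Omega>")
    case True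
    have "(\<phi> x)\<^sup>2 = v x * \<phi> x" for x by (auto simp: \<phi>_def max_def power2_eq_square)
    with True have "?X p = ((v (fst p) - v (snd p)) * (\<phi> (fst p) - \<phi> (snd p))) * \<kappa>"
      by (auto simp: I_def V_def F_def P_def algebra_simps)
    also have "\<dots> \<le> energy_density s v \<phi> p"
    proof (cases "fst p = snd p")
      case False
      then show ?thesis
        unfolding energy_density_def using True mono
        by (intro mult_left_mono \<kappa>(2)) (auto simp: \<phi>_def)
    qed (simp add: energy_density_def)
    finally show ?thesis
      using True by (auto simp: Q_region_def)
  next
    case False
    then have zero: "?X p = 0" by (auto simp: I_def V_def F_def P_def indicator_def mem_Times_iff)
    have "energy_density s v \<phi> p \<ge> 0"
      unfolding energy_density_def \<phi>_def by (intro mult_nonneg_nonneg mono frac_kernel_nonneg)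
    then show ?thesis
      unfolding zero by simp
  qed
  have "integral\<^sup>L lebesgue ?X \<le> (LINT p:Q_region \<Omega>|lebesgue. energy_density s v \<phi> p)"
    unfolding set_lebesgue_integral_def
    using X density le by (intro integral_mono) (auto simp: has_bochner_integral_iff)
  then have "2 * \<kappa> * (measure lebesgue \<Omega> * integral\<^sup>L lebesgue P - integral\<^sup>L lebesgue V * integral\<^sup>L lebesgue F)
    \<le> (LINT p:Q_region \<Omega>|lebesgue. energy_density s v \<phi> p)"
    using has_bochner_integral_integral_eq[OF X] \<Omega>(1) by (simp add: I_def algebra_simps)
  from mult_left_mono[OF this, of "frac_const TYPE('a) s / 2"] frac_const_pos[OF s, where 'a='a]
  show ?thesis
    by (simp add: energy_form_eq set_lebesgue_integral_def P_def[abs_def] V_def[abs_def] F_def[abs_def] mult.assoc)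
qed

text \<open>
  Each solution is tested with the other one, and both sides are the same value of the symmetric form.
\<close>

lemma mixed_weak_solution_swap:
  assumes "mixed_weak_solution s \<Omega> \<Sigma> f u" "mixed_weak_solution s \<Omega> \<Sigma> g v"
  shows "(LINT x:\<Omega>|lebesgue. f x * v x) = (LINT x:\<Omega>|lebesgue. g x * u x)"
  using assms energy_form_commute[of s \<Omega> u v] by (auto simp: mixed_weak_solution_def)

theorem theorem1p1:
  fixes s :: real and \<Omega> \<Sigma>\<^sub>1 \<Sigma>\<^sub>2 :: "'a::euclidean_space set"
  assumes "0 < s" and "s < 1"
    and "open \<Omega>" and "connected \<Omega>" and "\<Omega> \<noteq> {}" and "bounded \<Omega>"
    and "open \<Sigma>\<^sub>1" and "open \<Sigma>\<^sub>2"
    and "emeasure lebesgue \<Sigma>\<^sub>1 > 0" and "emeasure lebesgue \<Sigma>\<^sub>2 > 0"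
    and "\<Sigma>\<^sub>1 \<inter> \<Sigma>\<^sub>2 = {}"
    and "closure \<Sigma>\<^sub>1 \<union> closure \<Sigma>\<^sub>2 = UNIV - \<Omega>"
  shows "\<exists>c>0. \<forall>\<xi>\<^sub>0. mixed_weak_solution s \<Omega> \<Sigma>\<^sub>1 (\<lambda>x. 1) \<xi>\<^sub>0 \<longrightarrow>
           (\<forall>f\<in>test_functions \<Omega>. (\<forall>x. f x \<ge> 0) \<longrightarrow>
             (\<forall>u. mixed_weak_solution s \<Omega> \<Sigma>\<^sub>1 f u \<and> (AE x in lebesgue. u x \<ge> 0) \<longrightarrow>
               (AE x in lebesgue. x \<in> \<Omega> \<longrightarrow>
                 u x \<ge> c * set_lebesgue_integral lebesgue \<Omega> (\<lambda>y. f y * \<xi>\<^sub>0 y) * \<xi>\<^sub>0 x)))"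
proof -
  note s = \<open>0 < s\<close> \<open>s < 1\<close> and \<Omega> = \<open>open \<Omega>\<close> \<open>bounded \<Omega>\<close>
  let ?sol = "mixed_weak_solution s \<Omega> \<Sigma>\<^sub>1"
  obtain \<kappa> where \<kappa>: "\<kappa> > 0" "\<And>x y. x \<in> \<Omega> \<Longrightarrow> y \<in> \<Omega> \<Longrightarrow> x \<noteq> y \<Longrightarrow> \<kappa> \<le> frac_kernel s x y"
    using frac_kernel_lower_bound[OF s(1) \<Omega>(2)] by metis
  define b where "b = frac_const TYPE('a) s * \<kappa>"
  have b: "b > 0" using \<kappa>(1) frac_const_pos[OF s, where 'a='a] by (simp add: b_def)
  have mass_pos: "measure lebesgue \<Omega> > 0"
    using open_not_negligible[OF \<Omega>(1) \<open>\<Omega> \<noteq> {}\<close>] lmeasurable_open[OF \<Omega>(2,1)]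
    by (simp add: negligible_iff_measure zero_less_measure_iff)
  \<comment> \<open>The constant must be chosen before \<open>\<xi>\<^sub>0\<close>; it may depend on the mass of \<open>\<xi>\<^sub>0\<close> because all
    solutions with datum \<open>1\<close> have the same mass.\<close>
  obtain m where m: "m \<ge> 0" "\<And>\<xi>. ?sol (\<lambda>x. 1) \<xi> \<Longrightarrow> (LINT x:\<Omega>|lebesgue. \<xi> x) = m"
  proof (cases "\<exists>\<xi>. ?sol (\<lambda>x. 1) \<xi>")
    case True
    then obtain \<xi> where \<xi>: "?sol (\<lambda>x. 1) \<xi>" by blast
    have "(LINT x:\<Omega>|lebesgue. \<xi> x) = energy_form s \<Omega> \<xi> \<xi>"
      using \<xi> by (simp add: mixed_weak_solution_def)
    then have "(LINT x:\<Omega>|lebesgue. \<xi> x) \<ge> 0"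
      using energy_form_nonneg[OF s, of \<Omega> \<xi>] by simp
    moreover have "(LINT x:\<Omega>|lebesgue. \<eta> x) = (LINT x:\<Omega>|lebesgue. \<xi> x)" if "?sol (\<lambda>x. 1) \<eta>" for \<eta>
      using mixed_weak_solution_swap[OF \<xi> that] by simp
    ultimately show thesis by (rule that)
  next
    case False
    then show thesis using that[of 0] by blast
  qed
  define c where "c = b / (1 + b * m)"
  have pos: "1 + b * m > 0" using b m(1) by (simp add: add_pos_nonneg)
  show ?thesis
  proof (intro exI[of _ c] conjI allI ballI impI)
    show "c > 0" using b pos by (simp add: c_def)
  next
    fix \<xi> f u
    assume \<xi>: "?sol (\<lambda>x. 1) \<xi>" and f: "\<forall>x. f x \<ge> 0" and "?sol f u \<and> (AE x in lebesgue. u x \<ge> 0)"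
    then have u: "?sol f u" by simp
    have \<xi>E: "\<xi> \<in> energy_space s \<Omega> \<Sigma>\<^sub>1" and uE: "u \<in> energy_space s \<Omega> \<Sigma>\<^sub>1"
      using \<xi> u by (auto simp: mixed_weak_solution_def)
    define U where "U = (LINT x:\<Omega>|lebesgue. u x)"
    have U: "(LINT x:\<Omega>|lebesgue. f x * \<xi> x) = U"
      using mixed_weak_solution_swap[OF u \<xi>] by (simp add: U_def)
    define t where "t = c * U"
    \<comment> \<open>With this \<open>t\<close>, the constant datum of \<open>t * \<xi>\<close> in the problem with the zero-order term equals the
      lower bound \<open>b * U\<close> for the datum of \<open>u\<close>.\<close>
    have t: "t * (1 + b * m) = b * U"
      using pos by (simp add: t_def c_def)
    define v where "v x = t * \<xi> x - u x" for x
    define \<phi> where "\<phi> x = max (v x) 0" for x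
    have v: "v \<in> energy_space s \<Omega> \<Sigma>\<^sub>1"
      unfolding v_def[abs_def] by (rule energy_space_scale_diff[OF \<Omega>(1) \<xi>E uE])
    have \<phi>: "\<phi> \<in> energy_space s \<Omega> \<Sigma>\<^sub>1"
      unfolding \<phi>_def[abs_def] by (rule energy_space_pos_part[OF \<Omega>(1) v])
    define J S F where "J = (LINT x:\<Omega>|lebesgue. \<phi> x)" and "S = (LINT x:\<Omega>|lebesgue. (\<phi> x)\<^sup>2)"
      and "F = (LINT x:\<Omega>|lebesgue. f x * \<phi> x)"
    have "energy_form s \<Omega> v \<phi> = t * energy_form s \<Omega> \<xi> \<phi> - energy_form s \<Omega> u \<phi>"
      unfolding v_def[abs_def] by (rule energy_form_scale_diff[OF \<Omega>(1) \<xi>E uE \<phi>])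
    also have "\<dots> = t * J - F"
      using \<xi> u \<phi> by (simp add: mixed_weak_solution_def J_def F_def)
    finally have form: "energy_form s \<Omega> v \<phi> = t * J - F" .
    have "(LINT x:\<Omega>|lebesgue. v x) = t * m - U"
      unfolding v_def[abs_def] U_def m(2)[OF \<xi>, symmetric]
      using energy_space_integrable[OF \<Omega> \<xi>E] energy_space_integrable[OF \<Omega> uE]
      by (subst set_integral_diff(2)) auto
    then have "b * (measure lebesgue \<Omega> * S - (t * m - U) * J) \<le> t * J - F"
      using energy_form_pos_part_ge[OF s \<Omega> \<kappa> v] form 
      by (simp add: b_def \<phi>_def[abs_def] J_def S_def)
    moreover have "(t * (1 + b * m) - b * U) * J = 0"
      using t by simp
    \<comment> \<open>By the choice of \<open>t\<close> all multiples of the integral of \<open>\<phi>\<close> cancel.\<close>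
    ultimately have "(b * measure lebesgue \<Omega>) * S \<le> - F"
      by (simp add: algebra_simps)
    \<comment> \<open>The Bochner integral of a nonnegative function is nonnegative, whether or not it converges.\<close>
    moreover have "F \<ge> 0"
      unfolding F_def using f by (auto simp: set_lebesgue_integral_def \<phi>_def intro!: Bochner_Integration.integral_nonneg)
    ultimately have "(b * measure lebesgue \<Omega>) * S \<le> 0" by simp
    then have "S \<le> 0"
      using b mass_pos by (simp add: mult_le_0_iff zero_less_mult_iff)
    moreover have "S \<ge> 0"
      unfolding S_def by (auto simp: set_lebesgue_integral_def intro!: Bochner_Integration.integral_nonneg)
    ultimately have "S = 0" by simp
    then have "(LINT x|lebesgue. indicator \<Omega> x *\<^sub>R (\<phi> x)\<^sup>2) = 0"
      by (simp only: set_lebesgue_integral_def S_def)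
    moreover have "integrable lebesgue (\<lambda>x. indicator \<Omega> x *\<^sub>R (\<phi> x)\<^sup>2)"
      using \<phi> by (simp add: energy_space_iff[OF \<Omega>(1)] set_integrable_def)
    ultimately have "AE x in lebesgue. indicator \<Omega> x *\<^sub>R (\<phi> x)\<^sup>2 = 0"
      by (subst (asm) integral_nonneg_eq_0_iff_AE) auto
    then show "AE x in lebesgue. x \<in> \<Omega> \<longrightarrow>
        u x \<ge> c * set_lebesgue_integral lebesgue \<Omega> (\<lambda>y. f y * \<xi> y) * \<xi> x"
    proof eventually_elim
      case (elim x)
      then show ?case
        unfolding U t_def[symmetric] by (auto simp: \<phi>_def v_def max_def split: if_splits)
    qed
  qed
qed

end
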